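(* For $m\in\mathbb Z_{>0}$ and $J\subset[1,m-1]$, the assignments $$T_1\mapsto T_{w_\circ^{[1,2m-1]\cup(2m+J)}},\qquad T_2\mapsto T_{w_\circ^{[m+1,3m-1]\cup J}}$$ define a homomorphism $\mathrm{Br}^+_3\to\mathrm{Br}^+_{3m}$.
   Context: $\mathrm{Br}^+_k$ is the braid monoid on $k$ strands: generators $T_1,\dots,T_{k-1}$, relations $T_iT_{i+1}T_i=T_{i+1}T_iT_{i+1}$ and $T_iT_j=T_jT_i$ for $|i-j|>1$. For integers $a\le b$, $[a,b]=\{a,\dots,b\}$, and $[a,b]=\emptyset$ if $a>b$; $2m+J=\{2m+j:j\in J\}$. For $w\in S_k$ with reduced expression $w=s_{i_1}\cdots s_{i_r}$ in simple transpositions $s_i=(i,i+1)$, $T_w=T_{i_1}\cdots T_{i_r}\in\mathrm{Br}_k^+$. For $L\subset[1,k-1]$, $w_\circ^L$ is the longest element of the parabolic subgroup of $S_k$ generated by $s_l$, $l\in L$. *)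

theory Defs
  imports "HOL-Algebra.Sym_Groups"
begin

section \<open>Monoids given by generators and relations\<close>

inductive_set monoid_congruence :: "'a set \<Rightarrow> ('a list \<times> 'a list) set \<Rightarrow> ('a list \<times> 'a list) set"
  for A R where
    base: "(u, v) \<in> R \<Longrightarrow> u \<in> lists A \<Longrightarrow> v \<in> lists A \<Longrightarrow> (u, v) \<in> monoid_congruence A R"
  | refl: "u \<in> lists A \<Longrightarrow> (u, u) \<in> monoid_congruence A R"
  | sym: "(u, v) \<in> monoid_congruence A R \<Longrightarrow> (v, u) \<in> monoid_congruence A R"
  | trans: "(u, v) \<in> monoid_congruence A R \<Longrightarrow> (v, w) \<in> monoid_congruence A R
      \<Longrightarrow> (u, w) \<in> monoid_congruence A R"
  | append: "(u, v) \<in> monoid_congruence A R \<Longrightarrow> (u', v') \<in> monoid_congruence A R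
      \<Longrightarrow> (u @ u', v @ v') \<in> monoid_congruence A R"

definition presented_monoid :: "'a set \<Rightarrow> ('a list \<times> 'a list) set \<Rightarrow> 'a list set monoid"
  where "presented_monoid A R =
    \<lparr> carrier = lists A // monoid_congruence A R,
      mult = (\<lambda>X Y. \<Union>x\<in>X. \<Union>y\<in>Y. monoid_congruence A R `` {x @ y}),
      one = monoid_congruence A R `` {[]} \<rparr>"

lemma monoid_congruence_lists:
  "(u, v) \<in> monoid_congruence A R \<Longrightarrow> u \<in> lists A \<and> v \<in> lists A"
  by (induction rule: monoid_congruence.induct) auto

lemma equiv_monoid_congruence: "equiv (lists A) (monoid_congruence A R)"
proof (rule equivI)
  show "monoid_congruence A R \<subseteq> lists A \<times> lists A"
    by (rule subrelI) (blast dest: monoid_congruence_lists)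
  show "refl_on (lists A) (monoid_congruence A R)"
    by (intro refl_onI monoid_congruence.refl)
  show "Relation.sym (monoid_congruence A R)"
    by (rule symI) (rule monoid_congruence.sym)
  show "Relation.trans (monoid_congruence A R)"
    by (rule transI) (rule monoid_congruence.trans)
qed

lemma presented_monoid_mult:
  assumes "u \<in> lists A" "v \<in> lists A"
  shows "monoid_congruence A R `` {u} \<otimes>\<^bsub>presented_monoid A R\<^esub> monoid_congruence A R `` {v}
    = monoid_congruence A R `` {u @ v}"
proof -
  let ?C = "monoid_congruence A R"
  have eq: "?C `` {x @ y} = ?C `` {u @ v}" if "x \<in> ?C `` {u}" "y \<in> ?C `` {v}" for x y
    using that monoid_congruence.append[of u x A R v y]
    by (metis ImageE equiv_class_eq equiv_monoid_congruence singletonD)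
  have "u \<in> ?C `` {u}" "v \<in> ?C `` {v}"
    using assms by (blast intro: monoid_congruence.refl)+
  then have "(\<Union>x\<in>?C `` {u}. \<Union>y\<in>?C `` {v}. ?C `` {x @ y}) = ?C `` {u @ v}"
    using eq by (metis (no_types, lifting) UN_constant_eq)
  then show ?thesis
    by (simp only: presented_monoid_def monoid.simps)
qed

lemma monoid_presented_monoid: "monoid (presented_monoid A R)"
proof -
  have carr: "carrier (presented_monoid A R) = lists A // monoid_congruence A R"
    and one: "\<one>\<^bsub>presented_monoid A R\<^esub> = monoid_congruence A R `` {[]}"
    by (simp_all add: presented_monoid_def)
  note mult = presented_monoid_mult[where A = A and R = R]
  have closed: "monoid_congruence A R `` {u} \<in> carrier (presented_monoid A R)"
    if "u \<in> lists A" for u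
    unfolding carr using that by (rule quotientI)
  have nil: "[] \<in> lists A" by simp
  have app: "u @ v \<in> lists A" if "u \<in> lists A" "v \<in> lists A" for u v
    using that by simp
  show ?thesis
  proof (rule monoidI)
    show "\<one>\<^bsub>presented_monoid A R\<^esub> \<in> carrier (presented_monoid A R)"
      unfolding one by (rule closed[OF nil])
  next
    fix x assume "x \<in> carrier (presented_monoid A R)"
    then obtain u where u: "u \<in> lists A" and x: "x = monoid_congruence A R `` {u}"
      unfolding carr by (rule quotientE)
    show "\<one>\<^bsub>presented_monoid A R\<^esub> \<otimes>\<^bsub>presented_monoid A R\<^esub> x = x"
      unfolding one x mult[OF nil u] by (simp only: append_Nil)
    show "x \<otimes>\<^bsub>presented_monoid A R\<^esub> \<one>\<^bsub>presented_monoid A R\<^esub> = x"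
      unfolding one x mult[OF u nil] by (simp only: append_Nil2)
    fix y assume "y \<in> carrier (presented_monoid A R)"
    then obtain v where v: "v \<in> lists A" and y: "y = monoid_congruence A R `` {v}"
      unfolding carr by (rule quotientE)
    show "x \<otimes>\<^bsub>presented_monoid A R\<^esub> y \<in> carrier (presented_monoid A R)"
      unfolding x y mult[OF u v] by (rule closed[OF app[OF u v]])
    fix z assume "z \<in> carrier (presented_monoid A R)"
    then obtain w where w: "w \<in> lists A" and z: "z = monoid_congruence A R `` {w}"
      unfolding carr by (rule quotientE)
    show "x \<otimes>\<^bsub>presented_monoid A R\<^esub> y \<otimes>\<^bsub>presented_monoid A R\<^esub> z =
       x \<otimes>\<^bsub>presented_monoid A R\<^esub> (y \<otimes>\<^bsub>presented_monoid A R\<^esub> z)"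
      unfolding x y z mult[OF u v] mult[OF v w] mult[OF app[OF u v] w] mult[OF u app[OF v w]]
      by (simp only: append_assoc)
  qed
qed

definition monoid_homs :: "('a, 'c) monoid_scheme \<Rightarrow> ('b, 'd) monoid_scheme \<Rightarrow> ('a \<Rightarrow> 'b) set"
  where "monoid_homs M N = {\<phi> \<in> hom M N. \<phi> \<one>\<^bsub>M\<^esub> = \<one>\<^bsub>N\<^esub>}"

section \<open>The braid monoid\<close>

definition braid_relations :: "nat \<Rightarrow> (nat list \<times> nat list) set"
  where "braid_relations k =
    {([i, i + 1, i], [i + 1, i, i + 1]) | i. 1 \<le> i \<and> i + 1 < k} \<union>
    {([i, j], [j, i]) | i j. i \<in> {1..<k} \<and> j \<in> {1..<k} \<and> (i + 1 < j \<or> j + 1 < i)}"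

definition braid_monoid :: "nat \<Rightarrow> nat list set monoid"
  where "braid_monoid k = presented_monoid {1..<k} (braid_relations k)"

definition braid_gen :: "nat \<Rightarrow> nat \<Rightarrow> nat list set"
  where "braid_gen k i = monoid_congruence {1..<k} (braid_relations k) `` {[i]}"

section \<open>Reduced expressions and longest elements in symmetric groups\<close>

definition simple_transposition :: "nat \<Rightarrow> nat \<Rightarrow> nat"
  where "simple_transposition i = transpose i (i + 1)"

definition is_expression :: "nat \<Rightarrow> (nat \<Rightarrow> nat) \<Rightarrow> nat list \<Rightarrow> bool"
  where "is_expression k w is \<longleftrightarrow> is \<in> lists {1..<k} \<and>
    foldr (\<otimes>\<^bsub>sym_group k\<^esub>) (map simple_transposition is) \<one>\<^bsub>sym_group k\<^esub> = w"

definition perm_length :: "nat \<Rightarrow> (nat \<Rightarrow> nat) \<Rightarrow> nat"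
  where "perm_length k w = (LEAST n. \<exists>is. is_expression k w is \<and> length is = n)"

definition is_reduced_expression :: "nat \<Rightarrow> (nat \<Rightarrow> nat) \<Rightarrow> nat list \<Rightarrow> bool"
  where "is_reduced_expression k w is \<longleftrightarrow> is_expression k w is \<and> length is = perm_length k w"

text \<open>
  The product of the generators along a reduced expression of \<open>w\<close> is the same for all reduced
  expressions, by Matsumoto's theorem, so the choice below is immaterial.
\<close>

definition positive_lift :: "nat \<Rightarrow> (nat \<Rightarrow> nat) \<Rightarrow> nat list set"
  where "positive_lift k w =
    foldr (\<otimes>\<^bsub>braid_monoid k\<^esub>) (map (braid_gen k) (SOME is. is_reduced_expression k w is))
      \<one>\<^bsub>braid_monoid k\<^esub>"

definition parabolic :: "nat \<Rightarrow> nat set \<Rightarrow> (nat \<Rightarrow> nat) set"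
  where "parabolic k L = generate (sym_group k) (simple_transposition ` L)"

definition longest_element :: "nat \<Rightarrow> nat set \<Rightarrow> (nat \<Rightarrow> nat)"
  where "longest_element k L = (ARG_MAX (perm_length k) w. w \<in> parabolic k L)"

end

theory Submission
  imports Defs
begin

text \<open>
  Lengths of permutations are numbers of inversions, and by Matsumoto's theorem the positive lift is
  multiplicative on products in which no pair is inverted twice. Cut the \<open>3 m\<close> strands into three
  blocks of \<open>m\<close>, let \<open>\<Delta>\<close> be the half twist of a block, \<open>D\<close> the lift of the longest element of the
  parabolic subgroup of \<open>J\<close>, and \<open>X\<^sub>1\<close>, \<open>X\<^sub>2\<close> the positive swaps of adjacent blocks. The images of the
  two generators are \<open>X\<^sub>1 (\<Delta>, \<Delta>, D)\<close> and \<open>X\<^sub>2 (D, \<Delta>, \<Delta>)\<close>. Swaps slide past block-diagonal braids, so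
  both sides of the braid relation reduce to \<open>X\<^sub>1 X\<^sub>2 X\<^sub>1 = X\<^sub>2 X\<^sub>1 X\<^sub>2\<close> times the block-diagonal braids
  \<open>(D \<Delta> \<Delta>, \<Delta> D \<Delta>, \<Delta> \<Delta> D)\<close> and \<open>(\<Delta> \<Delta> D, \<Delta> D \<Delta>, D \<Delta> \<Delta>)\<close>, which agree because \<open>\<Delta>\<^sup>2\<close> is central.
\<close>

section \<open>Inversions and reduced expressions\<close>

definition inversions :: "(nat \<Rightarrow> nat) \<Rightarrow> (nat \<times> nat) set"
  where "inversions p = {(i, j). i < j \<and> p j < p i}"

text \<open>This amounts to \<open>inversions q \<subseteq> inversions (p \<circ> q)\<close>, the
  criterion for lengths to add. The pointwise form suits case distinctions on blocks.\<close>

definition no_double_inversion :: "(nat \<Rightarrow> nat) \<Rightarrow> (nat \<Rightarrow> nat) \<Rightarrow> bool"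
  where "no_double_inversion p q \<longleftrightarrow> (\<forall>i j. i < j \<longrightarrow> q j < q i \<longrightarrow> p (q j) < p (q i))"

lemma no_double_inversionI:
  "(\<And>i j. i < j \<Longrightarrow> q j < q i \<Longrightarrow> p (q j) < p (q i)) \<Longrightarrow> no_double_inversion p q"
  by (auto simp: no_double_inversion_def)

lemma no_double_inversion_id [simp]: "no_double_inversion p id" "no_double_inversion id p"
  by (auto simp: no_double_inversion_def)

lemma permutes_atLeastAtMost_le_iff:
  fixes p :: "nat \<Rightarrow> nat"
  assumes "p permutes {1..k}"
  shows "p i \<le> k \<longleftrightarrow> i \<le> k"
  using permutes_in_image[OF assms, of i] permutes_not_in[OF assms, of i] by fastforce

lemma permutes_atLeastAtMost_pos_iff:
  fixes p :: "nat \<Rightarrow> nat"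
  assumes "p permutes {1..k}"
  shows "p i > 0 \<longleftrightarrow> i > 0"
  using permutes_in_image[OF assms, of i] permutes_not_in[OF assms, of i] by fastforce

text \<open>Points outside \<open>{1..k}\<close> are fixed and lie on one side of all points inside,
  so they belong to no inverted pair. Hence inversions may be taken over all natural
  numbers.\<close>

lemma inversion_in_range:
  fixes p :: "nat \<Rightarrow> nat"
  assumes "p permutes {1..k}" "i < j" "p j < p i"
  shows "1 \<le> i \<and> j \<le> k"
proof -
  have "i > 0" using permutes_atLeastAtMost_pos_iff[OF assms(1), of i] assms(3) by simp
  moreover have "j \<le> k"
  proof (rule ccontr)
    assume "\<not> j \<le> k"
    then have "p j = j" by (intro permutes_not_in[OF assms(1)]) auto
    with \<open>\<not> j \<le> k\<close> assms(3) have "\<not> p i \<le> k" by simp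
    then have "p i = i"
      using permutes_atLeastAtMost_le_iff[OF assms(1), of i] permutes_not_in[OF assms(1), of i] by simp
    with \<open>p j = j\<close> assms(2,3) show False by simp
  qed
  ultimately show ?thesis by simp
qed

lemma inversions_subset:
  assumes "p permutes {1..k}"
  shows "inversions p \<subseteq> {1..k} \<times> {1..k}"
proof -
  have "i \<in> {1..k} \<and> j \<in> {1..k}" if "i < j" "p j < p i" for i j
    using inversion_in_range[OF assms that] that by simp
  then show ?thesis by (auto simp: inversions_def)
qed

lemma finite_inversions: "p permutes {1..k} \<Longrightarrow> finite (inversions p)"
  by (rule finite_subset[OF inversions_subset]) auto

lemma inversions_id [simp]: "inversions id = {}"
  by (auto simp: inversions_def)

text \<open>The inversions of \<open>p \<circ> q\<close> are those of \<open>q\<close> together with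
  the pairs that \<open>q\<close> keeps in order and \<open>p\<close> then inverts; \<open>q\<close>
  maps the latter bijectively onto the inversions of \<open>p\<close>.\<close>

lemma card_inversions_comp:
  assumes p: "p permutes {1..k}" and q: "q permutes {1..k}" and c: "no_double_inversion p q"
  shows "card (inversions (p \<circ> q)) = card (inversions p) + card (inversions q)"
proof -
  have fin: "finite (inversions (p \<circ> q))"
    by (rule finite_inversions[OF permutes_compose[OF q p]])
  have sub: "inversions q \<subseteq> inversions (p \<circ> q)"
    using c by (auto simp: inversions_def no_double_inversion_def)
  have "bij_betw (map_prod q q) (inversions (p \<circ> q) - inversions q) (inversions p)"
    unfolding bij_betw_def
  proof
    show "inj_on (map_prod q q) (inversions (p \<circ> q) - inversions q)"
      by (rule inj_on_subset[OF prod.inj_map]) (use permutes_inj[OF q] in auto)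
    show "map_prod q q ` (inversions (p \<circ> q) - inversions q) = inversions p"
    proof (intro equalityI subsetI)
      fix z assume "z \<in> map_prod q q ` (inversions (p \<circ> q) - inversions q)"
      then obtain i j where z: "z = (q i, q j)" and ij: "i < j" "p (q j) < p (q i)" "\<not> q j < q i"
        by (auto simp: inversions_def)
      then have "q i \<noteq> q j" by auto
      with z ij show "z \<in> inversions p" by (auto simp: inversions_def)
    next
      fix z assume "z \<in> inversions p"
      then obtain a b where z: "z = (a, b)" "a < b" "p b < p a" by (auto simp: inversions_def)
      obtain i j where ij: "a = q i" "b = q j"
        using permutes_surj[OF q] by (metis surjD)
      \<comment> \<open>In the other order, \<open>q\<close> would invert the pair and
        \<open>p\<close> would restore it.\<close>
      have "i < j"
      proof (rule ccontr)
        assume "\<not> i < j"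
        moreover have "i \<noteq> j" using ij z by auto
        ultimately have "j < i" by simp
        then show False using c z ij by (force simp: no_double_inversion_def)
      qed
      with z ij have "(i, j) \<in> inversions (p \<circ> q) - inversions q" by (auto simp: inversions_def)
      then show "z \<in> map_prod q q ` (inversions (p \<circ> q) - inversions q)"
        using z ij by force
    qed
  qed
  then have "card (inversions (p \<circ> q) - inversions q) = card (inversions p)"
    by (rule bij_betw_same_card)
  moreover have "card (inversions (p \<circ> q) - inversions q)
      = card (inversions (p \<circ> q)) - card (inversions q)"
    using sub fin by (meson card_Diff_subset finite_subset)
  moreover have "card (inversions q) \<le> card (inversions (p \<circ> q))"
    using sub fin by (rule card_mono[rotated])
  ultimately show ?thesis by simp
qed

text \<open>A strictly increasing map on the naturals never lies below the identity; this is applied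
  to \<open>p\<close> and to its inverse.\<close>

lemma strict_mono_permutation_eq_id:
  fixes p :: "nat \<Rightarrow> nat"
  assumes "p permutes S" "strict_mono p"
  shows "p = id"
proof
  fix x
  let ?q = "inv' p"
  have q: "p (?q y) = y" for y using permutes_inverses[OF assms(1)] by simp
  have "strict_mono ?q"
    by (rule strict_monoI) (metis assms(2) q strict_mono_less)
  then have "x \<le> p x" "p x \<le> ?q (p x)"
    using assms(2) by (auto intro: strict_mono_imp_increasing)
  then show "p x = id x" using permutes_inverses[OF assms(1)] by simp
qed

text \<open>Equal inversion sets make \<open>p \<circ> inv' q\<close> strictly increasing, hence the
  identity. Longest elements are identified in this way.\<close>

lemma permutation_eq_if_inversions_eq:
  assumes p: "p permutes {1..k}" and q: "q permutes {1..k}" and eq: "inversions p = inversions q"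
  shows "p = q"
proof -
  let ?r = "p \<circ> inv' q"
  have r: "?r permutes {1..k}" by (rule permutes_compose[OF permutes_inv[OF q] p])
  have q': "q (inv' q y) = y" for y using permutes_inverses[OF q] by simp
  have "strict_mono ?r"
  proof (rule strict_monoI)
    fix x y :: nat assume xy: "x < y"
    let ?i = "inv' q x" and ?j = "inv' q y"
    have ne: "?i \<noteq> ?j" using xy q' by (metis less_irrefl)
    then have ne': "p ?i \<noteq> p ?j" using permutes_inj[OF p] by (meson injD)
    have iff: "i < j \<Longrightarrow> p j < p i \<longleftrightarrow> q j < q i" for i j
      using eq by (auto simp: inversions_def set_eq_iff)
    show "?r x < ?r y"
      using iff[of ?i ?j] iff[of ?j ?i] ne ne' xy q' by (cases "?i < ?j") auto
  qed
  then have "?r = id" using strict_mono_permutation_eq_id[OF r] by blast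
  then show ?thesis using permutes_inverses[OF q] by (metis comp_apply eq_id_iff ext)
qed

section \<open>Simple transpositions, ascents and descents\<close>

lemma simple_transposition_apply:
  "simple_transposition i j = (if j = i then i + 1 else if j = i + 1 then i else j)"
  by (simp add: simple_transposition_def transpose_def)

lemma simple_transposition_permutes:
  "i \<in> {1..<k} \<Longrightarrow> simple_transposition i permutes {1..k}"
  unfolding simple_transposition_def by (rule permutes_swap_id) auto

lemma simple_transposition_involutory [simp]:
  "p \<circ> simple_transposition i \<circ> simple_transposition i = p"
  by (auto simp: simple_transposition_apply)

lemma simple_transposition_commute:
  "i + 1 < j \<or> j + 1 < i \<Longrightarrow>
    simple_transposition i \<circ> simple_transposition j = simple_transposition j \<circ> simple_transposition i"
  by (auto simp: simple_transposition_apply fun_eq_iff)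

lemma simple_transposition_braid:
  "simple_transposition i \<circ> simple_transposition (i + 1) \<circ> simple_transposition i
    = simple_transposition (i + 1) \<circ> simple_transposition i \<circ> simple_transposition (i + 1)"
  by (auto simp: simple_transposition_apply fun_eq_iff)

lemma inversions_simple_transposition: "inversions (simple_transposition i) = {(i, i + 1)}"
  by (auto simp: inversions_def simple_transposition_apply split: if_splits)

text \<open>The transposition inverts only the pair \<open>(i, i + 1)\<close>, and an ascent of
  \<open>p\<close> there means that \<open>p\<close> does not restore it.\<close>

lemma card_inversions_ascent:
  assumes p: "p permutes {1..k}" and i: "i \<in> {1..<k}" and lt: "p i < p (i + 1)"
  shows "card (inversions (p \<circ> simple_transposition i)) = card (inversions p) + 1"
proof -
  have "no_double_inversion p (simple_transposition i)"
    by (rule no_double_inversionI)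
      (use lt in \<open>auto simp: simple_transposition_apply split: if_splits\<close>)
  from card_inversions_comp[OF p simple_transposition_permutes[OF i] this]
  show ?thesis by (simp add: inversions_simple_transposition)
qed

lemma card_inversions_descent:
  assumes p: "p permutes {1..k}" and i: "i \<in> {1..<k}" and gt: "p (i + 1) < p i"
  shows "card (inversions p) = card (inversions (p \<circ> simple_transposition i)) + 1"
proof -
  have "(p \<circ> simple_transposition i) permutes {1..k}"
    by (rule permutes_compose[OF simple_transposition_permutes[OF i] p])
  \<comment> \<open>The product has an ascent at \<open>i\<close>, and a second transposition leads
    back to \<open>p\<close>.\<close>
  from card_inversions_ascent[OF this i] gt
  show ?thesis by (simp add: simple_transposition_apply)
qed

lemma permutes_adjacent_cases:
  assumes "(p :: nat \<Rightarrow> nat) permutes S"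
  obtains "p i < p (i + 1)" | "p (i + 1) < p i"
  using permutes_inj[OF assms] by (metis linorder_neqE_nat n_not_Suc_n Suc_eq_plus1 injD)

lemma exists_descent:
  assumes p: "(p :: nat \<Rightarrow> nat) permutes {1..k}" and ne: "p \<noteq> id"
  obtains i where "i \<in> {1..<k}" "p (i + 1) < p i"
proof -
  have "\<not> strict_mono p" using strict_mono_permutation_eq_id[OF p] ne by blast
  then obtain i where i: "\<not> p i < p (Suc i)"
    using strict_mono_Suc_iff by blast
  then have "p (i + 1) < p i"
    by (cases rule: permutes_adjacent_cases[OF p, of i]) auto
  with inversion_in_range[OF p _ this] that[of i] show ?thesis by auto
qed

section \<open>Words in the simple transpositions and reduced words\<close>

definition word_perm :: "nat list \<Rightarrow> nat \<Rightarrow> nat"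
  where "word_perm is = foldr (\<circ>) (map simple_transposition is) id"

lemma word_perm_Nil [simp]: "word_perm [] = id"
  by (simp add: word_perm_def)

lemma word_perm_append: "word_perm (is @ js) = word_perm is \<circ> word_perm js"
  by (induction "is") (auto simp: word_perm_def fun_eq_iff)

lemma word_perm_snoc [simp]: "word_perm (is @ [i]) = word_perm is \<circ> simple_transposition i"
  unfolding word_perm_append by (simp add: word_perm_def)

lemma word_perm_permutes: "is \<in> lists {1..<k} \<Longrightarrow> word_perm is permutes {1..k}"
proof (induction "is" rule: rev_induct)
  case (snoc i "is")
  then show ?case
    using permutes_compose[OF simple_transposition_permutes[of i k], of "word_perm is"]
    by (simp del: comp_apply)
qed (simp add: permutes_id)

text \<open>Each letter changes the number of inversions by exactly one, up or down.\<close>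

lemma card_inversions_word_perm_le:
  "is \<in> lists {1..<k} \<Longrightarrow> card (inversions (word_perm is)) \<le> length is"
proof (induction "is" rule: rev_induct)
  case (snoc i "is")
  then have "is": "is \<in> lists {1..<k}" and i: "i \<in> {1..<k}"
    and IH: "card (inversions (word_perm is)) \<le> length is"
    by simp_all
  have p: "word_perm is permutes {1..k}" by (rule word_perm_permutes[OF "is"])
  show ?case
    using card_inversions_ascent[OF p i] card_inversions_descent[OF p i] IH
    by (cases rule: permutes_adjacent_cases[OF p, of i]) (simp_all del: comp_apply)
qed simp

text \<open>Length is measured by inversions, which can be computed;
  \<open>is_reduced_expression_iff\<close> later shows agreement with minimality among
  expressions.\<close>

definition reduced_word :: "nat \<Rightarrow> (nat \<Rightarrow> nat) \<Rightarrow> nat list \<Rightarrow> bool"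
  where "reduced_word k w is \<longleftrightarrow>
    is \<in> lists {1..<k} \<and> word_perm is = w \<and> length is = card (inversions w)"

lemma reduced_word_permutes: "reduced_word k w is \<Longrightarrow> w permutes {1..k}"
  unfolding reduced_word_def using word_perm_permutes by blast

lemma reduced_word_snocI:
  assumes "reduced_word k (w \<circ> simple_transposition i) is" "w permutes {1..k}" "i \<in> {1..<k}"
    and "w (i + 1) < w i"
  shows "reduced_word k w (is @ [i])"
  using assms card_inversions_descent[OF assms(2-4)] by (auto simp: reduced_word_def)

lemma reduced_word_snocD:
  assumes "reduced_word k w (is @ [i])"
  shows "i \<in> {1..<k}" "w (i + 1) < w i" "reduced_word k (w \<circ> simple_transposition i) is"
proof -
  have w: "w permutes {1..k}" by (rule reduced_word_permutes[OF assms])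
  have "is": "is \<in> lists {1..<k}" and i: "i \<in> {1..<k}"
    and eq: "word_perm is \<circ> simple_transposition i = w"
    and len: "length is + 1 = card (inversions w)"
    using assms by (auto simp: reduced_word_def)
  have eq': "word_perm is = w \<circ> simple_transposition i"
    unfolding eq[symmetric] by simp
  then have le: "card (inversions (w \<circ> simple_transposition i)) \<le> length is"
    using card_inversions_word_perm_le[OF "is"] by simp
  show "i \<in> {1..<k}" by fact
  \<comment> \<open>An ascent would give the shortened permutation more inversions than
    \<open>is\<close> has letters.\<close>
  show lt: "w (i + 1) < w i"
    using card_inversions_ascent[OF w i] le len
    by (cases rule: permutes_adjacent_cases[OF w, of i]) auto
  show "reduced_word k (w \<circ> simple_transposition i) is"
    using card_inversions_descent[OF w i lt] len eq' "is" by (simp add: reduced_word_def)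
qed

text \<open>Induction on the number of inversions: a permutation other than the identity has a
  descent, and stripping it loses one inversion.\<close>

lemma reduced_word_exists:
  assumes "w permutes {1..k}"
  obtains "is" where "reduced_word k w is"
proof -
  have "\<exists>is. reduced_word k w is"
    using assms
  proof (induction "card (inversions w)" arbitrary: w rule: less_induct)
    case less
    show ?case
    proof (cases "w = id")
      case True
      then have "reduced_word k w []" by (auto simp: reduced_word_def)
      then show ?thesis ..
    next
      case False
      then obtain i where i: "i \<in> {1..<k}" "w (i + 1) < w i"
        using exists_descent[OF less.prems] by blast
      have "(w \<circ> simple_transposition i) permutes {1..k}"
        by (rule permutes_compose[OF simple_transposition_permutes[OF i(1)] less.prems])
      then obtain "is" where "reduced_word k (w \<circ> simple_transposition i) is"
        using less.hyps card_inversions_descent[OF less.prems i] by fastforce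
      then show ?thesis using reduced_word_snocI less.prems i by blast
    qed
  qed
  then show ?thesis using that by blast
qed

section \<open>Matsumoto's theorem\<close>

abbreviation braid_congruence :: "nat \<Rightarrow> (nat list \<times> nat list) set"
  where "braid_congruence k \<equiv> monoid_congruence {1..<k} (braid_relations k)"

lemma monoid_congruence_prefix:
  assumes "x \<in> lists A" "(u, v) \<in> R" "u \<in> lists A" "v \<in> lists A"
  shows "(x @ u, x @ v) \<in> monoid_congruence A R"
  using assms by (intro monoid_congruence.append monoid_congruence.refl monoid_congruence.base)

lemma monoid_congruence_snoc:
  assumes "(u, v) \<in> monoid_congruence A R" "a \<in> A"
  shows "(u @ [a], v @ [a]) \<in> monoid_congruence A R"
  using assms by (intro monoid_congruence.append monoid_congruence.refl) auto

text \<open>Both words are compared with words that end in the two sides of the braid relation after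
  a common prefix \<open>x\<close>; the induction hypothesis handles everything but that last
  relation.\<close>

lemma matsumoto_braid_step:
  assumes IH: "\<And>w u v. length u < n \<Longrightarrow> reduced_word k w u \<Longrightarrow> reduced_word k w v
      \<Longrightarrow> (u, v) \<in> braid_congruence k"
    and u: "reduced_word k w (u @ [i])" and v: "reduced_word k w (v @ [i + 1])"
    and len: "length u < n" "length v < n"
  shows "(u @ [i], v @ [i + 1]) \<in> braid_congruence k"
proof -
  let ?s = simple_transposition
  note ui = reduced_word_snocD[OF u] and vi = reduced_word_snocD[OF v]
  have w1: "(w \<circ> ?s i) permutes {1..k}" and w2: "(w \<circ> ?s (i + 1)) permutes {1..k}"
    using ui(3) vi(3) by (auto dest: reduced_word_permutes)
  have w11: "(w \<circ> ?s i \<circ> ?s (i + 1)) permutes {1..k}"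
    and w22: "(w \<circ> ?s (i + 1) \<circ> ?s i) permutes {1..k}"
    using permutes_compose[OF simple_transposition_permutes[OF vi(1)] w1]
      permutes_compose[OF simple_transposition_permutes[OF ui(1)] w2] by auto
  have "(w \<circ> ?s i \<circ> ?s (i + 1) \<circ> ?s i) permutes {1..k}"
    by (rule permutes_compose[OF simple_transposition_permutes[OF ui(1)] w11])
  \<comment> \<open>Descents at \<open>i\<close> and \<open>i + 1\<close> mean that \<open>w\<close>
    reverses three consecutive points, so the longest element on these points splits off;
    \<open>x\<close> spells what remains.\<close>
  then obtain x where x: "reduced_word k (w \<circ> ?s i \<circ> ?s (i + 1) \<circ> ?s i) x"
    by (rule reduced_word_exists)
  have x': "reduced_word k (w \<circ> ?s (i + 1) \<circ> ?s i \<circ> ?s (i + 1)) x"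
    using x simple_transposition_braid[of i] by (metis comp_assoc)
  have "reduced_word k (w \<circ> ?s i \<circ> ?s (i + 1)) (x @ [i])"
    by (rule reduced_word_snocI[OF x w11 ui(1)]) (use vi(2) in \<open>simp add: simple_transposition_apply\<close>)
  then have "reduced_word k (w \<circ> ?s i) ((x @ [i]) @ [i + 1])"
    by (rule reduced_word_snocI[OF _ w1 vi(1)]) (use ui(2) vi(2) in \<open>simp add: simple_transposition_apply\<close>)
  with ui(3) have "(u, (x @ [i]) @ [i + 1]) \<in> braid_congruence k" by (rule IH[OF len(1)])
  from monoid_congruence_snoc[OF this ui(1)]
  have 1: "(u @ [i], x @ [i, i + 1, i]) \<in> braid_congruence k" by simp
  have "reduced_word k (w \<circ> ?s (i + 1) \<circ> ?s i) (x @ [i + 1])"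
    by (rule reduced_word_snocI[OF x' w22 vi(1)]) (use ui(2) in \<open>simp add: simple_transposition_apply\<close>)
  then have "reduced_word k (w \<circ> ?s (i + 1)) ((x @ [i + 1]) @ [i])"
    by (rule reduced_word_snocI[OF _ w2 ui(1)]) (use ui(2) vi(2) in \<open>simp add: simple_transposition_apply\<close>)
  with vi(3) have "(v, (x @ [i + 1]) @ [i]) \<in> braid_congruence k" by (rule IH[OF len(2)])
  from monoid_congruence_snoc[OF this vi(1)]
  have 2: "(v @ [i + 1], x @ [i + 1, i, i + 1]) \<in> braid_congruence k" by simp
  have "(x @ [i, i + 1, i], x @ [i + 1, i, i + 1]) \<in> braid_congruence k"
    by (rule monoid_congruence_prefix)
      (use x ui(1) vi(1) in \<open>auto simp: reduced_word_def braid_relations_def\<close>)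
  with 1 2 show ?thesis by (meson monoid_congruence.sym monoid_congruence.trans)
qed

text \<open>As in the braid step, with two distant descents split off and a commutation as the last
  relation.\<close>

lemma matsumoto_commuting_step:
  assumes IH: "\<And>w u v. length u < n \<Longrightarrow> reduced_word k w u \<Longrightarrow> reduced_word k w v
      \<Longrightarrow> (u, v) \<in> braid_congruence k"
    and u: "reduced_word k w (u @ [i])" and v: "reduced_word k w (v @ [j])"
    and len: "length u < n" "length v < n" and far: "i + 1 < j \<or> j + 1 < i"
  shows "(u @ [i], v @ [j]) \<in> braid_congruence k"
proof -
  let ?s = simple_transposition
  note ui = reduced_word_snocD[OF u] and vj = reduced_word_snocD[OF v]
  have w1: "(w \<circ> ?s i) permutes {1..k}" and w2: "(w \<circ> ?s j) permutes {1..k}"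
    using ui(3) vj(3) by (auto dest: reduced_word_permutes)
  have "(w \<circ> ?s i \<circ> ?s j) permutes {1..k}"
    by (rule permutes_compose[OF simple_transposition_permutes[OF vj(1)] w1])
  then obtain x where x: "reduced_word k (w \<circ> ?s i \<circ> ?s j) x" by (rule reduced_word_exists)
  have x': "reduced_word k (w \<circ> ?s j \<circ> ?s i) x"
    using x simple_transposition_commute[OF far] by (metis comp_assoc)
  have "reduced_word k (w \<circ> ?s i) (x @ [j])"
    by (rule reduced_word_snocI[OF x w1 vj(1)]) (use vj(2) far in \<open>auto simp: simple_transposition_apply\<close>)
  with ui(3) have "(u, x @ [j]) \<in> braid_congruence k" by (rule IH[OF len(1)])
  from monoid_congruence_snoc[OF this ui(1)]
  have 1: "(u @ [i], x @ [j, i]) \<in> braid_congruence k" by simp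
  have "reduced_word k (w \<circ> ?s j) (x @ [i])"
    by (rule reduced_word_snocI[OF x' w2 ui(1)]) (use ui(2) far in \<open>auto simp: simple_transposition_apply\<close>)
  with vj(3) have "(v, x @ [i]) \<in> braid_congruence k" by (rule IH[OF len(2)])
  from monoid_congruence_snoc[OF this vj(1)]
  have 2: "(v @ [j], x @ [i, j]) \<in> braid_congruence k" by simp
  have "(x @ [j, i], x @ [i, j]) \<in> braid_congruence k"
    by (rule monoid_congruence_prefix)
      (use x ui(1) vj(1) far in \<open>auto simp: reduced_word_def braid_relations_def\<close>)
  with 1 2 show ?thesis by (meson monoid_congruence.sym monoid_congruence.trans)
qed

text \<open>Induction on the length, comparing the last letters: equal ones are dropped, adjacent
  ones use the braid relation, distant ones commute.\<close>

theorem matsumoto: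
  assumes "reduced_word k w u" "reduced_word k w v"
  shows "(u, v) \<in> braid_congruence k"
  using assms
proof (induction "length u" arbitrary: w u v rule: less_induct)
  case less
  have len: "length u = length v" using less.prems by (simp add: reduced_word_def)
  show ?case
  proof (cases u rule: rev_cases)
    case Nil
    then show ?thesis using len by (auto intro: monoid_congruence.refl)
  next
    case (snoc u' i)
    then obtain v' j where v: "v = v' @ [j]"
      using len by (cases v rule: rev_cases) auto
    have lu: "length u' < length u" and lv: "length v' < length u" using snoc v len by auto
    note pu = less.prems(1)[unfolded snoc] and pv = less.prems(2)[unfolded v]
    consider "i = j" | "j = i + 1" | "i = j + 1" | "i + 1 < j \<or> j + 1 < i" by linarith
    then show ?thesis
    proof cases
      case 1
      then have "(u', v') \<in> braid_congruence k"
        using less.hyps[OF lu] reduced_word_snocD(3)[OF pu] reduced_word_snocD(3)[OF pv] by simp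
      then show ?thesis
        unfolding snoc v 1 using reduced_word_snocD(1)[OF pv] by (rule monoid_congruence_snoc)
    next
      case 2
      show ?thesis
        unfolding snoc v 2
        by (rule matsumoto_braid_step[OF less.hyps pu pv[unfolded 2] lu lv])
    next
      case 3
      show ?thesis
        unfolding snoc v 3
        by (rule monoid_congruence.sym, rule matsumoto_braid_step[OF less.hyps pv pu[unfolded 3] lv lu])
    next
      case 4
      show ?thesis
        unfolding snoc v by (rule matsumoto_commuting_step[OF less.hyps pu pv lu lv 4])
    qed
  qed
qed

section \<open>The positive lift\<close>

lemma is_expression_iff: "is_expression k w is \<longleftrightarrow> is \<in> lists {1..<k} \<and> word_perm is = w"
  by (simp add: is_expression_def word_perm_def sym_group_def)

text \<open>No expression has fewer letters than inversions, and a reduced word attains this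
  bound.\<close>

lemma perm_length_eq_card_inversions:
  assumes "w permutes {1..k}"
  shows "perm_length k w = card (inversions w)"
proof -
  obtain "is" where "is": "reduced_word k w is" using reduced_word_exists[OF assms] .
  show ?thesis
    unfolding perm_length_def
  proof (rule Least_equality)
    show "\<exists>is. is_expression k w is \<and> length is = card (inversions w)"
      using "is" by (auto simp: is_expression_iff reduced_word_def)
    show "card (inversions w) \<le> n" if "\<exists>is. is_expression k w is \<and> length is = n" for n
      using that card_inversions_word_perm_le unfolding is_expression_iff by blast
  qed
qed

lemma is_reduced_expression_iff:
  "w permutes {1..k} \<Longrightarrow> is_reduced_expression k w is \<longleftrightarrow> reduced_word k w is"
  by (auto simp: is_reduced_expression_def is_expression_iff reduced_word_def
      perm_length_eq_card_inversions)

lemma presented_monoid_carrierI: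
  "u \<in> lists A \<Longrightarrow> monoid_congruence A R `` {u} \<in> carrier (presented_monoid A R)"
  by (simp add: presented_monoid_def quotientI)

lemma presented_monoid_one: "\<one>\<^bsub>presented_monoid A R\<^esub> = monoid_congruence A R `` {[]}"
  by (simp add: presented_monoid_def)

lemma foldr_presented_monoid:
  "u \<in> lists A \<Longrightarrow>
    foldr (\<otimes>\<^bsub>presented_monoid A R\<^esub>) (map (\<lambda>a. monoid_congruence A R `` {[a]}) u)
      \<one>\<^bsub>presented_monoid A R\<^esub> = monoid_congruence A R `` {u}"
proof (induction u)
  case (Cons a u)
  then show ?case using presented_monoid_mult[of "[a]" A u R] by simp
qed (simp add: presented_monoid_one)

text \<open>Matsumoto's theorem makes the word picked by \<open>SOME\<close> equivalent to any given
  reduced word.\<close>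

lemma positive_lift_reduced_word:
  assumes "reduced_word k w is"
  shows "positive_lift k w = braid_congruence k `` {is}"
proof -
  let ?js = "SOME is. is_reduced_expression k w is"
  have w: "w permutes {1..k}" by (rule reduced_word_permutes[OF assms])
  have js: "reduced_word k w ?js"
    using assms unfolding is_reduced_expression_iff[OF w] by (rule someI)
  have "positive_lift k w = braid_congruence k `` {?js}"
    unfolding positive_lift_def braid_monoid_def braid_gen_def[abs_def]
    by (rule foldr_presented_monoid) (use js in \<open>simp add: reduced_word_def\<close>)
  also have "\<dots> = braid_congruence k `` {is}"
    by (rule equiv_class_eq[OF equiv_monoid_congruence matsumoto[OF js assms]])
  finally show ?thesis .
qed

lemma monoid_braid_monoid: "monoid (braid_monoid k)"
  unfolding braid_monoid_def by (rule monoid_presented_monoid)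

lemma positive_lift_closed:
  assumes "w permutes {1..k}"
  shows "positive_lift k w \<in> carrier (braid_monoid k)"
proof -
  obtain "is" where "is": "reduced_word k w is" using reduced_word_exists[OF assms] .
  then show ?thesis
    unfolding positive_lift_reduced_word[OF "is"] braid_monoid_def
    by (intro presented_monoid_carrierI) (simp add: reduced_word_def)
qed

text \<open>Since inversion numbers add, the concatenation of reduced words for \<open>p\<close> and
  \<open>q\<close> is reduced for the product.\<close>

lemma positive_lift_comp:
  assumes p: "p permutes {1..k}" and q: "q permutes {1..k}" and "no_double_inversion p q"
  shows "positive_lift k (p \<circ> q) = positive_lift k p \<otimes>\<^bsub>braid_monoid k\<^esub> positive_lift k q"
proof -
  obtain u v where u: "reduced_word k p u" and v: "reduced_word k q v"
    using reduced_word_exists[OF p] reduced_word_exists[OF q] by metis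
  have "reduced_word k (p \<circ> q) (u @ v)"
    using u v card_inversions_comp[OF assms] by (auto simp: reduced_word_def word_perm_append)
  moreover have "u \<in> lists {1..<k}" "v \<in> lists {1..<k}"
    using u v by (simp_all add: reduced_word_def)
  ultimately show ?thesis
    unfolding braid_monoid_def
    by (simp only: positive_lift_reduced_word[OF u] positive_lift_reduced_word[OF v]
        positive_lift_reduced_word presented_monoid_mult)
qed

section \<open>Longest elements of parabolic subgroups\<close>

text \<open>
  Membership in the parabolic subgroup is expressed by the invariance of the initial segments
  \<open>{..c}\<close> for \<open>c \<notin> L\<close>, and maximality by a descent at every \<open>i \<in> L\<close>.
\<close>

definition longest_in_parabolic :: "nat set \<Rightarrow> (nat \<Rightarrow> nat) \<Rightarrow> bool"
  where "longest_in_parabolic L w \<longleftrightarrow>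
    (\<forall>c x. c \<notin> L \<longrightarrow> (w x \<le> c \<longleftrightarrow> x \<le> c)) \<and> (\<forall>i\<in>L. w (i + 1) < w i)"

text \<open>A cut at some \<open>c \<notin> L\<close> keeps points on its two sides in order, while
  descents along a run inside \<open>L\<close> chain together. So \<open>L\<close> alone determines
  the inversions.\<close>

lemma inversions_longest_in_parabolic:
  assumes "longest_in_parabolic L w"
  shows "inversions w = {(i, j). i < j \<and> {i..<j} \<subseteq> L}"
proof -
  have "{i..<j} \<subseteq> L" if "i < j" "w j < w i" for i j
  proof
    fix c assume c: "c \<in> {i..<j}"
    show "c \<in> L"
    proof (rule ccontr)
      assume "c \<notin> L"
      then have "w i \<le> c" "\<not> w j \<le> c"
        using assms c by (auto simp: longest_in_parabolic_def)
      then show False using that by simp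
    qed
  qed
  moreover have "w j < w i" if "i < j" "{i..<j} \<subseteq> L" for i j
    using that
  proof (induction j rule: nat_induct)
    case (Suc j)
    have "j \<in> L" using Suc.prems by auto
    then have "w (Suc j) < w j"
      using assms by (simp add: longest_in_parabolic_def)
    moreover have "w j \<le> w i" if "i \<noteq> j" using Suc that by fastforce
    ultimately show ?case by (cases "i = j") auto
  qed simp
  ultimately show ?thesis by (auto simp: inversions_def)
qed

lemma parabolic_permutes:
  assumes "L \<subseteq> {1..<k}" "w \<in> parabolic k L"
  shows "w permutes {1..k}"
proof -
  have "simple_transposition ` L \<subseteq> carrier (sym_group k)"
    using assms(1) simple_transposition_permutes by (auto simp: sym_group_def)
  from group.generate_in_carrier[OF sym_group_is_group this] assms(2)
  show ?thesis by (simp add: parabolic_def sym_group_def)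
qed

text \<open>Only the transposition at \<open>c\<close> moves points across the cut after
  \<open>c\<close>, and it is not among the generators.\<close>

lemma parabolic_le_iff:
  assumes L: "L \<subseteq> {1..<k}" and w: "w \<in> parabolic k L" and c: "c \<notin> L"
  shows "w x \<le> c \<longleftrightarrow> x \<le> c"
proof -
  have s: "simple_transposition i x \<le> c \<longleftrightarrow> x \<le> c" if "i \<in> L" for i x
    using that c by (cases "i = c") (auto simp: simple_transposition_apply)
  have "\<forall>x. w x \<le> c \<longleftrightarrow> x \<le> c"
    using w unfolding parabolic_def
  proof (induction rule: generate.induct)
    case (inv h)
    then obtain i where i: "i \<in> L" "h = simple_transposition i" by auto
    have mem: "h \<in> carrier (sym_group k)"
      using i L simple_transposition_permutes by (auto simp: sym_group_def)
    \<comment> \<open>Generators are involutions, so inverses need no separate argument.\<close>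
    have "inv\<^bsub>sym_group k\<^esub> h = h"
      by (rule group.inv_equality[OF sym_group_is_group _ mem mem])
        (use i in \<open>auto simp: sym_group_def simple_transposition_def\<close>)
    then show ?case using i s by simp
  qed (auto simp: sym_group_def s)
  then show ?thesis by blast
qed

lemma longest_element:
  assumes L: "L \<subseteq> {1..<k}"
  shows "longest_element k L permutes {1..k}" "longest_in_parabolic L (longest_element k L)"
proof -
  let ?w = "longest_element k L"
  have len: "perm_length k w = card (inversions w)" if "w \<in> parabolic k L" for w
    using perm_length_eq_card_inversions parabolic_permutes[OF L that] by blast
  \<comment> \<open>\<open>ARG_MAX\<close> attains a maximum only if the lengths are bounded; the
    added one makes the bound strict, as \<open>arg_max_nat_lemma\<close> demands.\<close>
  have bound: "perm_length k w < card ({1..k} \<times> {1..k}) + 1" if "w \<in> parabolic k L" for w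
    unfolding len[OF that]
    using card_mono[OF _ inversions_subset[OF parabolic_permutes[OF L that]]] by simp
  have "\<one>\<^bsub>sym_group k\<^esub> \<in> parabolic k L" unfolding parabolic_def by (rule generate.one)
  from arg_max_nat_lemma[of "\<lambda>w. w \<in> parabolic k L", OF this, of "perm_length k"] bound
  have mem: "?w \<in> parabolic k L"
    and max: "\<And>v. v \<in> parabolic k L \<Longrightarrow> perm_length k v \<le> perm_length k ?w"
    unfolding longest_element_def by blast+
  show w: "?w permutes {1..k}" by (rule parabolic_permutes[OF L mem])
  \<comment> \<open>Without this descent, multiplying by the transposition at \<open>i\<close> would
    give a longer element of the same subgroup.\<close>
  have "?w (i + 1) < ?w i" if i: "i \<in> L" for i
  proof (rule ccontr)
    assume "\<not> ?w (i + 1) < ?w i"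
    then have "?w i < ?w (i + 1)" by (cases rule: permutes_adjacent_cases[OF w, of i]) auto
    moreover have "?w \<circ> simple_transposition i \<in> parabolic k L"
      using generate.eng[OF mem[unfolded parabolic_def]
          generate.incl[of "simple_transposition i" "simple_transposition ` L"]] i
      by (simp add: parabolic_def sym_group_def)
    moreover have "i \<in> {1..<k}" using i L by auto
    ultimately show False
      using max[of "?w \<circ> simple_transposition i"] card_inversions_ascent[OF w, of i] mem
      by (simp add: len)
  qed
  then show "longest_in_parabolic L ?w"
    using parabolic_le_iff[OF L mem] by (simp add: longest_in_parabolic_def)
qed

text \<open>Both permutations have the inversion set prescribed by \<open>L\<close>. A longest
  element is thus recognized by checking cuts and descents, without any maximization.\<close>

lemma longest_element_eqI:
  assumes "L \<subseteq> {1..<k}" "w permutes {1..k}" "longest_in_parabolic L w"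
  shows "longest_element k L = w"
  using permutation_eq_if_inversions_eq[OF longest_element(1)[OF assms(1)] assms(2)]
    inversions_longest_in_parabolic longest_element(2)[OF assms(1)] assms(3) by simp


section \<open>The universal property of presented monoids\<close>

context monoid
begin

definition evaluate :: "('c \<Rightarrow> 'a) \<Rightarrow> 'c list \<Rightarrow> 'a"
  where "evaluate f u = foldr (\<otimes>) (map f u) \<one>"

lemma evaluate_simps [simp]:
  "evaluate f [] = \<one>" "evaluate f (a # u) = f a \<otimes> evaluate f u"
  by (simp_all add: evaluate_def)

lemma evaluate_closed: "f \<in> A \<rightarrow> carrier G \<Longrightarrow> u \<in> lists A \<Longrightarrow> evaluate f u \<in> carrier G"
  by (induction u) auto

lemma evaluate_append:
  "f \<in> A \<rightarrow> carrier G \<Longrightarrow> u \<in> lists A \<Longrightarrow> v \<in> lists A \<Longrightarrow>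
    evaluate f (u @ v) = evaluate f u \<otimes> evaluate f v"
proof (induction u)
  case (Cons a u)
  then have "f a \<in> carrier G" by auto
  with Cons show ?case by (auto simp: m_assoc evaluate_closed)
qed (simp add: evaluate_closed)

lemma evaluate_monoid_congruence:
  assumes f: "f \<in> A \<rightarrow> carrier G"
    and rel: "\<And>u v. (u, v) \<in> R \<Longrightarrow> evaluate f u = evaluate f v"
    and "(u, v) \<in> monoid_congruence A R"
  shows "evaluate f u = evaluate f v"
  using assms(3)
proof (induction rule: monoid_congruence.induct)
  case (append u v u' v')
  then have "u \<in> lists A" "v \<in> lists A" "u' \<in> lists A" "v' \<in> lists A"
    by (blast dest: monoid_congruence_lists)+
  with append.IH show ?case by (simp only: evaluate_append[OF f])
qed (auto intro: rel)

text \<open>Extensionality fixes the values outside the carrier; without it, a total function could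
  not be unique.\<close>

theorem presented_monoid_universal:
  assumes f: "f \<in> A \<rightarrow> carrier G"
    and rel: "\<And>u v. (u, v) \<in> R \<Longrightarrow> evaluate f u = evaluate f v"
  shows "\<exists>!\<phi>. \<phi> \<in> monoid_homs (presented_monoid A R) G
    \<and> \<phi> \<in> extensional (carrier (presented_monoid A R))
    \<and> (\<forall>a\<in>A. \<phi> (monoid_congruence A R `` {[a]}) = f a)"
    (is "\<exists>!\<phi>. ?P \<phi>")
proof -
  let ?M = "presented_monoid A R" and ?C = "\<lambda>u. monoid_congruence A R `` {u}"
  have carrierE: thesis
    if "X \<in> carrier ?M" and "\<And>u. u \<in> lists A \<Longrightarrow> X = ?C u \<Longrightarrow> thesis" for X thesis
  proof -
    have "X \<in> lists A // monoid_congruence A R" using that(1) by (simp add: presented_monoid_def)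
    then show thesis by (rule quotientE) (rule that(2))
  qed
  have closed: "?C u \<in> carrier ?M" if "u \<in> lists A" for u
    using that by (rule presented_monoid_carrierI)
  have image: "evaluate f ` ?C u = {evaluate f u}" if "u \<in> lists A" for u
  proof -
    have "evaluate f v = evaluate f u" if "v \<in> ?C u" for v
      using evaluate_monoid_congruence[OF f rel] that by (metis Image_singleton_iff)
    moreover have "u \<in> ?C u" using that by (simp add: monoid_congruence.refl)
    ultimately show ?thesis by blast
  qed
  \<comment> \<open>Evaluation is constant on a congruence class, so its image is a singleton and
    \<open>the_elem\<close> extracts the common value.\<close>
  define \<psi> where "\<psi> = restrict (\<lambda>X. the_elem (evaluate f ` X)) (carrier ?M)"
  have \<psi>: "\<psi> (?C u) = evaluate f u" if "u \<in> lists A" for u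
    using closed[OF that] image[OF that] by (simp add: \<psi>_def)
  have "\<psi> \<in> hom ?M G"
  proof (rule homI)
    fix X assume "X \<in> carrier ?M"
    then obtain u where u: "u \<in> lists A" "X = ?C u" by (rule carrierE)
    then show "\<psi> X \<in> carrier G" using \<psi> evaluate_closed[OF f] by simp
    fix Y assume "Y \<in> carrier ?M"
    then obtain v where v: "v \<in> lists A" "Y = ?C v" by (rule carrierE)
    have uv: "u @ v \<in> lists A" using u v by simp
    show "\<psi> (X \<otimes>\<^bsub>?M\<^esub> Y) = \<psi> X \<otimes> \<psi> Y"
      unfolding u(2) v(2) presented_monoid_mult[OF u(1) v(1)] \<psi>[OF uv] \<psi>[OF u(1)] \<psi>[OF v(1)]
      by (rule evaluate_append[OF f u(1) v(1)])
  qed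
  then have "\<psi> \<in> monoid_homs ?M G"
    using \<psi>[of "[]"] by (simp add: monoid_homs_def presented_monoid_one)
  moreover have "\<forall>a\<in>A. \<psi> (?C [a]) = f a"
    using \<psi> f by (auto simp: Pi_iff)
  ultimately have ex: "?P \<psi>" by (simp add: \<psi>_def)
  have unique: "\<phi> X = \<psi> X" if P: "?P \<phi>" for \<phi> X
  proof (cases "X \<in> carrier ?M")
    case True
    then obtain u where u: "u \<in> lists A" "X = ?C u" by (rule carrierE)
    \<comment> \<open>A homomorphism is determined letter by letter on the representing
      word.\<close>
    have "\<phi> (?C u) = evaluate f u"
      using u(1)
    proof (induction u)
      case Nil
      then show ?case using P by (simp add: monoid_homs_def presented_monoid_one)
    next
      case (Cons a u)
      then have a: "[a] \<in> lists A" "a \<in> A" and u: "u \<in> lists A" by auto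
      have "?C (a # u) = ?C [a] \<otimes>\<^bsub>?M\<^esub> ?C u"
        using presented_monoid_mult[OF a(1) u] by simp
      moreover have "\<phi> (?C [a] \<otimes>\<^bsub>?M\<^esub> ?C u) = \<phi> (?C [a]) \<otimes> \<phi> (?C u)"
        using P closed[OF a(1)] closed[OF u] by (auto simp: monoid_homs_def hom_mult)
      ultimately show ?case using P a(2) Cons.IH by simp
    qed
    then show ?thesis using u \<psi> by simp
  next
    case False
    then show ?thesis using P ex by (simp add: extensional_def)
  qed
  show ?thesis by (rule ex1I[of ?P, OF ex]) (use unique in blast)
qed

end

text \<open>The two generators are adjacent, so no commutation relation arises, and the only braid
  relation is the one with \<open>i = 1\<close>.\<close>

lemma braid_relations_3:
  assumes "(u, v) \<in> braid_relations 3"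
  shows "u = [1, 2, 1]" "v = [2, 1, 2]"
proof -
  obtain i where "u = [i, i + 1, i]" "v = [i + 1, i, i + 1]" "1 \<le> i" "i + 1 < 3"
  proof -
    have "\<not> (i \<in> {1..<3} \<and> j \<in> {1..<3} \<and> (i + 1 < j \<or> j + 1 < i))" for i j :: nat by simp
    with assms that show thesis unfolding braid_relations_def by blast
  qed
  moreover from this have "i = 1" by simp
  ultimately show "u = [1, 2, 1]" "v = [2, 1, 2]" by simp_all
qed

section \<open>Permutations of three blocks\<close>

text \<open>The longest element of the symmetric group on one block; its positive lift is the half
  twist.\<close>

definition reversal :: "nat \<Rightarrow> nat \<Rightarrow> nat"
  where "reversal m i = (if i \<in> {1..m} then m + 1 - i else i)"

text \<open>The embedding of a product of three symmetric groups as block-diagonal permutations. The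
  point 0 is left to \<open>a\<close>, which fixes it whenever \<open>a\<close> permutes
  \<open>{1..m}\<close>.\<close>

definition block_sum ::
  "nat \<Rightarrow> (nat \<Rightarrow> nat) \<Rightarrow> (nat \<Rightarrow> nat) \<Rightarrow> (nat \<Rightarrow> nat) \<Rightarrow> nat \<Rightarrow> nat"
  where "block_sum m a b c i =
    (if i \<le> m then a i else if i \<le> 2 * m then m + b (i - m)
     else if i \<le> 3 * m then 2 * m + c (i - 2 * m) else i)"

text \<open>Blocks are translated, so strands of the same block never cross. The point 0 needs its
  own clause because it also satisfies \<open>i \<le> m\<close>.\<close>

definition block_swap12 :: "nat \<Rightarrow> nat \<Rightarrow> nat"
  where "block_swap12 m i =
    (if i = 0 then 0 else if i \<le> m then i + m else if i \<le> 2 * m then i - m else i)"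

definition block_swap23 :: "nat \<Rightarrow> nat \<Rightarrow> nat"
  where "block_swap23 m i =
    (if i \<le> m then i else if i \<le> 2 * m then i + m else if i \<le> 3 * m then i - m else i)"

lemma permutes_if_inverse:
  assumes "\<And>x. x \<notin> S \<Longrightarrow> p x = x" "q \<circ> p = id" "p \<circ> q = id"
  shows "p permutes S"
  using assms unfolding permutes_def by (metis comp_apply id_apply)

lemma reversal_involutory [simp]: "reversal m (reversal m i) = i" "reversal m \<circ> reversal m = id"
  by (auto simp: reversal_def fun_eq_iff)

lemma reversal_permutes: "reversal m permutes {1..m}"
  by (rule permutes_if_inverse[where q = "reversal m"]) (auto simp: reversal_def)

lemma permutes_block_bounds:
  fixes p :: "nat \<Rightarrow> nat"
  assumes "p permutes {1..m}"
  shows "i \<le> m \<Longrightarrow> p i \<le> m" "i > 0 \<Longrightarrow> p i > 0"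
  using permutes_atLeastAtMost_le_iff[OF assms] permutes_atLeastAtMost_pos_iff[OF assms] by auto

lemma block_sum_comp:
  assumes "a' permutes {1..m}" "b' permutes {1..m}" "c' permutes {1..m}"
  shows "block_sum m a b c \<circ> block_sum m a' b' c' = block_sum m (a \<circ> a') (b \<circ> b') (c \<circ> c')"
proof
  fix i
  consider "i \<le> m" | "m < i" "i \<le> 2 * m" | "2 * m < i" "i \<le> 3 * m" | "3 * m < i" by linarith
  then show "(block_sum m a b c \<circ> block_sum m a' b' c') i
      = block_sum m (a \<circ> a') (b \<circ> b') (c \<circ> c') i"
  proof cases
    case 1
    with permutes_block_bounds[OF assms(1)] show ?thesis by (simp add: block_sum_def)
  next
    case 2
    with permutes_block_bounds[OF assms(2), of "i - m"] show ?thesis by (simp add: block_sum_def)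
  next
    case 3
    with permutes_block_bounds[OF assms(3), of "i - 2 * m"] show ?thesis by (simp add: block_sum_def)
  qed (simp add: block_sum_def)
qed

lemma block_sum_id: "block_sum m id id id = id"
  by (auto simp: block_sum_def fun_eq_iff)

lemma block_sum_permutes:
  assumes "a permutes {1..m}" "b permutes {1..m}" "c permutes {1..m}"
  shows "block_sum m a b c permutes {1..3 * m}"
proof (rule permutes_if_inverse[where q = "block_sum m (inv' a) (inv' b) (inv' c)"])
  show "block_sum m a b c x = x" if "x \<notin> {1..3 * m}" for x
    using that permutes_not_in[OF assms(1), of 0] by (cases "x = 0") (auto simp: block_sum_def)
qed (simp_all only: block_sum_comp assms permutes_inv permutes_inv_o[OF assms(1)]
    permutes_inv_o[OF assms(2)] permutes_inv_o[OF assms(3)] block_sum_id)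

text \<open>A block sum inverts only pairs inside one block, so the condition can be checked in each
  block separately.\<close>

lemma no_double_inversion_block_sum:
  assumes a: "a permutes {1..m}" "a' permutes {1..m}" "no_double_inversion a a'"
    and b: "b permutes {1..m}" "b' permutes {1..m}" "no_double_inversion b b'"
    and c: "c permutes {1..m}" "c' permutes {1..m}" "no_double_inversion c c'"
  shows "no_double_inversion (block_sum m a b c) (block_sum m a' b' c')"
proof (rule no_double_inversionI)
  fix i j :: nat
  assume lt: "i < j" and inversion: "block_sum m a' b' c' j < block_sum m a' b' c' i"
  note A = permutes_block_bounds[OF a(1)] permutes_block_bounds[OF a(2)]
  note B = permutes_block_bounds[OF b(1)] permutes_block_bounds[OF b(2)]
  note C = permutes_block_bounds[OF c(1)] permutes_block_bounds[OF c(2)]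
  \<comment> \<open>The cuts after each block are preserved.\<close>
  have bounds: "x \<le> m \<Longrightarrow> block_sum m a' b' c' x \<le> m"
    "x > m \<Longrightarrow> block_sum m a' b' c' x > m"
    "x \<le> 2 * m \<Longrightarrow> block_sum m a' b' c' x \<le> 2 * m"
    "x > 2 * m \<Longrightarrow> block_sum m a' b' c' x > 2 * m"
    "x \<le> 3 * m \<Longrightarrow> block_sum m a' b' c' x \<le> 3 * m"
    "x > 3 * m \<Longrightarrow> block_sum m a' b' c' x > 3 * m" for x
  proof -
    have "x - m \<le> m \<longleftrightarrow> x \<le> 2 * m" "x - 2 * m \<le> m \<longleftrightarrow> x \<le> 3 * m" by auto
    then show "x \<le> m \<Longrightarrow> block_sum m a' b' c' x \<le> m"
      "x > m \<Longrightarrow> block_sum m a' b' c' x > m"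
      "x \<le> 2 * m \<Longrightarrow> block_sum m a' b' c' x \<le> 2 * m"
      "x > 2 * m \<Longrightarrow> block_sum m a' b' c' x > 2 * m"
      "x \<le> 3 * m \<Longrightarrow> block_sum m a' b' c' x \<le> 3 * m"
      "x > 3 * m \<Longrightarrow> block_sum m a' b' c' x > 3 * m"
      using A(3,4)[of x] B(3,4)[of "x - m"] C(3,4)[of "x - 2 * m"] unfolding block_sum_def by auto
  qed
  \<comment> \<open>Either both points share a block, or they lie beyond all blocks, or a cut
    separates them; the last two possibilities contradict the inversion.\<close>
  consider "j \<le> m" | "m < i" "j \<le> 2 * m" | "2 * m < i" "j \<le> 3 * m" | "3 * m < i"
    | "i \<le> m" "m < j" | "i \<le> 2 * m" "2 * m < j" | "i \<le> 3 * m" "3 * m < j"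
    using lt by linarith
  then show "block_sum m a b c (block_sum m a' b' c' j) < block_sum m a b c (block_sum m a' b' c' i)"
  proof cases
    case 1
    then show ?thesis
      using lt inversion a(3) A(3) by (simp add: block_sum_def no_double_inversion_def)
  next
    case 2
    then have "b (b' (j - m)) < b (b' (i - m))"
      using lt inversion b(3) by (simp add: block_sum_def no_double_inversion_def)
    then show ?thesis
      using 2 lt B(3,4)[of "j - m"] B(3,4)[of "i - m"] by (simp add: block_sum_def)
  next
    case 3
    then have "c (c' (j - 2 * m)) < c (c' (i - 2 * m))"
      using lt inversion c(3) by (simp add: block_sum_def no_double_inversion_def)
    then show ?thesis
      using 3 lt C(3,4)[of "j - 2 * m"] C(3,4)[of "i - 2 * m"] by (simp add: block_sum_def)
  next
    case 4
    then show ?thesis using lt inversion by (simp add: block_sum_def)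
  next
    case 5
    then show ?thesis using inversion bounds(1)[of i] bounds(2)[of j] by simp
  next
    case 6
    then show ?thesis using inversion bounds(3)[of i] bounds(4)[of j] by simp
  next
    case 7
    then show ?thesis using inversion bounds(5)[of i] bounds(6)[of j] by simp
  qed
qed

text \<open>The reversal inverts every pair of \<open>{1..m}\<close>, so in a factorization of it no
  pair can be restored.\<close>

lemma no_double_inversion_reversal:
  assumes "q permutes {1..m}" "p \<circ> q = reversal m"
  shows "no_double_inversion p q"
proof (rule no_double_inversionI)
  fix i j :: nat
  assume ij: "i < j" "q j < q i"
  have "p (q x) = reversal m x" for x using assms(2) by (metis comp_apply)
  moreover have "i \<in> {1..m}" "j \<in> {1..m}" using inversion_in_range[OF assms(1) ij] ij by simp_all
  ultimately show "p (q j) < p (q i)" using ij by (auto simp: reversal_def)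
qed

lemma block_swap12_permutes: "block_swap12 m permutes {1..3 * m}"
  by (rule permutes_if_inverse[where q = "block_swap12 m"]) (auto simp: block_swap12_def fun_eq_iff)

lemma block_swap23_permutes: "block_swap23 m permutes {1..3 * m}"
  by (rule permutes_if_inverse[where q = "block_swap23 m"]) (auto simp: block_swap23_def fun_eq_iff)

lemma block_swap_braid:
  "block_swap12 m \<circ> block_swap23 m \<circ> block_swap12 m = block_swap23 m \<circ> block_swap12 m \<circ> block_swap23 m"
  by (auto simp: block_swap12_def block_swap23_def fun_eq_iff)

text \<open>In these products every two blocks cross at most once. This allows
  \<open>block_swap_braid\<close> to be lifted to the braid monoid.\<close>

lemma no_double_inversion_block_swaps:
  "no_double_inversion (block_swap12 m) (block_swap23 m)"
  "no_double_inversion (block_swap23 m) (block_swap12 m)"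
  "no_double_inversion (block_swap12 m \<circ> block_swap23 m) (block_swap12 m)"
  "no_double_inversion (block_swap23 m \<circ> block_swap12 m) (block_swap23 m)"
  by (rule no_double_inversionI; auto simp: block_swap12_def block_swap23_def split: if_splits)+

section \<open>Block swaps against block sums\<close>

context
  fixes m :: nat and a b c :: "nat \<Rightarrow> nat"
  assumes a: "a permutes {1..m}" and b: "b permutes {1..m}" and c: "c permutes {1..m}"
begin

lemma block_sum_bounds:
  "block_sum m a b c i = 0 \<longleftrightarrow> i = 0"
  "block_sum m a b c i \<le> m \<longleftrightarrow> i \<le> m"
  "block_sum m a b c i \<le> 2 * m \<longleftrightarrow> i \<le> 2 * m"
  "block_sum m a b c i \<le> 3 * m \<longleftrightarrow> i \<le> 3 * m"
proof -
  have "i - m \<le> m \<longleftrightarrow> i \<le> 2 * m" "i - 2 * m \<le> m \<longleftrightarrow> i \<le> 3 * m" by auto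
  then show "block_sum m a b c i = 0 \<longleftrightarrow> i = 0"
    "block_sum m a b c i \<le> m \<longleftrightarrow> i \<le> m"
    "block_sum m a b c i \<le> 2 * m \<longleftrightarrow> i \<le> 2 * m"
    "block_sum m a b c i \<le> 3 * m \<longleftrightarrow> i \<le> 3 * m"
    using permutes_block_bounds[OF a, of i] permutes_block_bounds[OF b, of "i - m"]
      permutes_block_bounds[OF c, of "i - 2 * m"] permutes_atLeastAtMost_pos_iff[OF a, of i]
    unfolding block_sum_def by auto
qed

lemma block_swap12_block_sum:
  "block_sum m a b c \<circ> block_swap12 m = block_swap12 m \<circ> block_sum m b a c"
proof
  fix i
  show "(block_sum m a b c \<circ> block_swap12 m) i = (block_swap12 m \<circ> block_sum m b a c) i"
    using permutes_block_bounds[OF a, of "i - m"] permutes_block_bounds[OF b, of i]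
      permutes_block_bounds[OF c, of "i - 2 * m"] permutes_atLeastAtMost_pos_iff[OF a, of 0]
      permutes_atLeastAtMost_pos_iff[OF b, of 0]
    by (auto simp: block_sum_def block_swap12_def)
qed

lemma block_swap23_block_sum:
  "block_sum m a b c \<circ> block_swap23 m = block_swap23 m \<circ> block_sum m a c b"
proof
  fix i
  show "(block_sum m a b c \<circ> block_swap23 m) i = (block_swap23 m \<circ> block_sum m a c b) i"
  proof -
    have "i - m - m = i - 2 * m" by simp
    moreover have "i - m \<le> m \<longleftrightarrow> i \<le> 2 * m" "i - 2 * m \<le> m \<longleftrightarrow> i \<le> 3 * m" by auto
    ultimately show ?thesis
      using permutes_block_bounds[OF a, of i] permutes_block_bounds[OF b, of "i - 2 * m"]
        permutes_block_bounds[OF c, of "i - m"]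
      by (auto simp: block_sum_def block_swap23_def)
  qed
qed

text \<open>A swap inverts only pairs whose images lie in different blocks, and a block sum never
  changes the order of blocks.\<close>

lemma no_double_inversion_block_sum_swap:
  "no_double_inversion (block_sum m a b c) (block_swap12 m)"
  "no_double_inversion (block_sum m a b c) (block_swap23 m)"
proof -
  have *: "block_sum m a b c i < block_sum m a b c j"
    if "i \<le> m \<and> m < j \<or> i \<le> 2 * m \<and> 2 * m < j" for i j
    using that block_sum_bounds(2,3)[of i] block_sum_bounds(2,3)[of j] by linarith
  show "no_double_inversion (block_sum m a b c) (block_swap12 m)"
    by (rule no_double_inversionI, rule *) (auto simp: block_swap12_def split: if_splits)
  show "no_double_inversion (block_sum m a b c) (block_swap23 m)"
    by (rule no_double_inversionI, rule *) (auto simp: block_swap23_def split: if_splits)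
qed

text \<open>Conversely, a block sum inverts only pairs inside one block, which a swap merely
  translates.\<close>

lemma no_double_inversion_swap_block_sum:
  "no_double_inversion (block_swap12 m) (block_sum m a b c)"
  "no_double_inversion (block_swap23 m) (block_sum m a b c)"
proof -
  have range: "1 \<le> i \<and> (j \<le> m \<or> m < i \<and> j \<le> 2 * m \<or> 2 * m < i \<and> j \<le> 3 * m)"
    if "i < j" "block_sum m a b c j < block_sum m a b c i" for i j
    using that inversion_in_range[OF block_sum_permutes[OF a b c] that]
      block_sum_bounds(2,3)[of i] block_sum_bounds(2,3)[of j] by linarith
  show "no_double_inversion (block_swap12 m) (block_sum m a b c)"
  proof (rule no_double_inversionI)
    fix i j assume *: "i < j" "block_sum m a b c j < block_sum m a b c i"
    show "block_swap12 m (block_sum m a b c j) < block_swap12 m (block_sum m a b c i)"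
      using range[OF *] * block_sum_bounds[of i] block_sum_bounds[of j]
      by (auto simp: block_swap12_def)
  qed
  show "no_double_inversion (block_swap23 m) (block_sum m a b c)"
  proof (rule no_double_inversionI)
    fix i j assume *: "i < j" "block_sum m a b c j < block_sum m a b c i"
    show "block_swap23 m (block_sum m a b c j) < block_swap23 m (block_sum m a b c i)"
      using range[OF *] * block_sum_bounds[of i] block_sum_bounds[of j]
      by (auto simp: block_swap23_def)
  qed
qed

end

section \<open>The two longest elements\<close>

context
  fixes m :: nat and J :: "nat set" and d :: "nat \<Rightarrow> nat"
  assumes J: "J \<subseteq> {1..m - 1}" and d: "d permutes {1..m}" and longest: "longest_in_parabolic J d"
begin

text \<open>Reversing two blocks and then swapping them reverses their union
  \<open>{1..2 * m}\<close>; the third block carries a shifted copy of \<open>d\<close>.\<close>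

lemma longest_element_left:
  "longest_element (3 * m) ({1..2 * m - 1} \<union> (+) (2 * m) ` J)
    = block_swap12 m \<circ> block_sum m (reversal m) (reversal m) d"
    (is "longest_element _ ?L = ?w")
proof (rule longest_element_eqI)
  show "?L \<subseteq> {1..<3 * m}" using J by fastforce
  show "?w permutes {1..3 * m}"
    by (rule permutes_compose[OF block_sum_permutes block_swap12_permutes])
      (simp_all add: reversal_permutes d del: One_nat_def)
  have w: "?w i = (if 1 \<le> i \<and> i \<le> 2 * m then 2 * m + 1 - i
      else if 2 * m < i \<and> i \<le> 3 * m then 2 * m + d (i - 2 * m) else i)" for i
    using permutes_block_bounds[OF d, of "i - 2 * m"]
    by (auto simp: block_sum_def block_swap12_def reversal_def)
  show "longest_in_parabolic ?L ?w"
    unfolding longest_in_parabolic_def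
  proof (intro conjI allI impI ballI)
    fix c x assume c: "c \<notin> ?L"
    \<comment> \<open>A cut outside the generating set is either at 0 or at a place where it
      restricts to a cut of \<open>d\<close> in the third block.\<close>
    have "c - 2 * m \<notin> J" if "2 * m \<le> c"
    proof
      assume "c - 2 * m \<in> J"
      then have "2 * m + (c - 2 * m) \<in> ?L" by blast
      with c that show False by simp
    qed
    moreover from c have "c = 0 \<or> 2 * m \<le> c" by auto
    ultimately consider "c = 0" | "2 * m \<le> c" "c - 2 * m \<notin> J" by blast
    then show "?w x \<le> c \<longleftrightarrow> x \<le> c"
    proof cases
      case 1
      then show ?thesis unfolding w by auto
    next
      case 2
      then have "d (x - 2 * m) \<le> c - 2 * m \<longleftrightarrow> x - 2 * m \<le> c - 2 * m"
        using longest by (simp add: longest_in_parabolic_def)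
      then show ?thesis using 2 unfolding w by (cases "x \<le> 2 * m") auto
    qed
  next
    fix i assume "i \<in> ?L"
    then consider "1 \<le> i" "i + 1 \<le> 2 * m" | j where "j \<in> J" "i = 2 * m + j" by fastforce
    then show "?w (i + 1) < ?w i"
    proof cases
      case 1
      then show ?thesis unfolding w by simp
    next
      case 2
      moreover have "1 \<le> j" "j + 1 \<le> m" using J 2 by fastforce+
      moreover have "d (j + 1) < d j" using longest 2 by (simp add: longest_in_parabolic_def)
      ultimately show ?thesis unfolding w by simp
    qed
  qed
qed

text \<open>The mirror case: blocks two and three are reversed as a whole, and \<open>d\<close> acts
  on the first block without a shift.\<close>

lemma longest_element_right:
  "longest_element (3 * m) ({m + 1..3 * m - 1} \<union> J)
    = block_swap23 m \<circ> block_sum m d (reversal m) (reversal m)"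
    (is "longest_element _ ?L = ?w")
proof (rule longest_element_eqI)
  show "?L \<subseteq> {1..<3 * m}" using J by fastforce
  show "?w permutes {1..3 * m}"
    by (rule permutes_compose[OF block_sum_permutes block_swap23_permutes])
      (simp_all add: reversal_permutes d del: One_nat_def)
  have w: "?w i = (if i \<le> m then d i else if i \<le> 3 * m then 4 * m + 1 - i else i)" for i
    using permutes_block_bounds[OF d, of i]
    by (auto simp: block_sum_def block_swap23_def reversal_def)
  show "longest_in_parabolic ?L ?w"
    unfolding longest_in_parabolic_def
  proof (intro conjI allI impI ballI)
    fix c x assume c: "c \<notin> ?L"
    then have *: "d x \<le> c \<longleftrightarrow> x \<le> c"
      using longest by (simp add: longest_in_parabolic_def)
    from c consider "c \<le> m" | "3 * m \<le> c" by fastforce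
    then show "?w x \<le> c \<longleftrightarrow> x \<le> c"
      using * permutes_block_bounds(1)[OF d, of x] unfolding w by cases auto
  next
    fix i assume "i \<in> ?L"
    then consider "m + 1 \<le> i" "i + 1 \<le> 3 * m" | "i \<in> J" by fastforce
    then show "?w (i + 1) < ?w i"
    proof cases
      case 1
      then show ?thesis unfolding w by simp
    next
      case 2
      moreover have "i + 1 \<le> m" using J 2 by fastforce
      moreover have "d (i + 1) < d i" using longest 2 by (simp add: longest_in_parabolic_def)
      ultimately show ?thesis unfolding w by simp
    qed
  qed
qed

end

section \<open>The braid relation\<close>

text \<open>Here \<open>x\<close>, \<open>y\<close> stand for the swaps and \<open>p\<close>,
  \<open>q\<close>, \<open>s\<close> for block-diagonal braids with the exceptional component in the
  third, second and first block. Moving the swaps to the left yields \<open>x y x s q p\<close> and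
  \<open>y x y p q s\<close>.\<close>

lemma (in monoid) braid_relation_of_swaps:
  assumes [simp]: "x \<in> carrier G" "y \<in> carrier G" "p \<in> carrier G" "q \<in> carrier G" "s \<in> carrier G"
    and swaps: "p \<otimes> y = y \<otimes> q" "q \<otimes> y = y \<otimes> p" "s \<otimes> x = x \<otimes> q" "q \<otimes> x = x \<otimes> s"
    and xyx: "x \<otimes> y \<otimes> x = y \<otimes> x \<otimes> y" and sqp: "s \<otimes> q \<otimes> p = p \<otimes> q \<otimes> s"
  shows "(x \<otimes> p) \<otimes> (y \<otimes> s) \<otimes> (x \<otimes> p) = (y \<otimes> s) \<otimes> (x \<otimes> p) \<otimes> (y \<otimes> s)"
proof -
  \<comment> \<open>The swap rules with a trailing factor, so that they still apply once products
    are associated to the right.\<close>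
  have past: "p \<otimes> (y \<otimes> z) = y \<otimes> (q \<otimes> z)" "q \<otimes> (y \<otimes> z) = y \<otimes> (p \<otimes> z)"
    "s \<otimes> (x \<otimes> z) = x \<otimes> (q \<otimes> z)" "q \<otimes> (x \<otimes> z) = x \<otimes> (s \<otimes> z)"
    if [simp]: "z \<in> carrier G" for z
    using swaps by (simp_all flip: m_assoc)
  have "(x \<otimes> p) \<otimes> (y \<otimes> s) \<otimes> (x \<otimes> p) = (x \<otimes> y \<otimes> x) \<otimes> (s \<otimes> q \<otimes> p)"
    by (simp add: m_assoc past)
  also have "\<dots> = (y \<otimes> x \<otimes> y) \<otimes> (p \<otimes> q \<otimes> s)" by (simp only: xyx sqp)
  also have "\<dots> = (y \<otimes> s) \<otimes> (x \<otimes> p) \<otimes> (y \<otimes> s)" by (simp add: m_assoc past)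
  finally show ?thesis .
qed

context
  fixes m :: nat
begin

abbreviation block_lift :: "(nat \<Rightarrow> nat) \<Rightarrow> (nat \<Rightarrow> nat) \<Rightarrow> (nat \<Rightarrow> nat) \<Rightarrow> nat list set"
  where "block_lift a b c \<equiv> positive_lift (3 * m) (block_sum m a b c)"

abbreviation braid_mult :: "nat list set \<Rightarrow> nat list set \<Rightarrow> nat list set" (infixl "\<cdot>" 70)
  where "x \<cdot> y \<equiv> x \<otimes>\<^bsub>braid_monoid (3 * m)\<^esub> y"

interpretation monoid "braid_monoid (3 * m)"
  by (rule monoid_braid_monoid)

lemma block_lift_closed:
  assumes "a permutes {1..m}" "b permutes {1..m}" "c permutes {1..m}"
  shows "block_lift a b c \<in> carrier (braid_monoid (3 * m))"
  by (rule positive_lift_closed[OF block_sum_permutes[OF assms]])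

lemma block_lift_mult:
  assumes "a permutes {1..m}" "a' permutes {1..m}" "no_double_inversion a a'"
    and "b permutes {1..m}" "b' permutes {1..m}" "no_double_inversion b b'"
    and "c permutes {1..m}" "c' permutes {1..m}" "no_double_inversion c c'"
  shows "block_lift a b c \<cdot> block_lift a' b' c' = block_lift (a \<circ> a') (b \<circ> b') (c \<circ> c')"
  using positive_lift_comp[OF block_sum_permutes[OF assms(1,4,7)] block_sum_permutes[OF assms(2,5,8)]
      no_double_inversion_block_sum[OF assms]]
  by (simp add: block_sum_comp[OF assms(2,5,8)])

text \<open>Both products lift the same permutation, and neither inverts a pair twice.\<close>

lemma block_lift_swap12:
  assumes "a permutes {1..m}" "b permutes {1..m}" "c permutes {1..m}"
  shows "block_lift a b c \<cdot> positive_lift (3 * m) (block_swap12 m)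
    = positive_lift (3 * m) (block_swap12 m) \<cdot> block_lift b a c"
  using positive_lift_comp[OF block_sum_permutes[OF assms] block_swap12_permutes
      no_double_inversion_block_sum_swap(1)[OF assms]]
    positive_lift_comp[OF block_swap12_permutes block_sum_permutes[OF assms(2,1,3)]
      no_double_inversion_swap_block_sum(1)[OF assms(2,1,3)]]
    block_swap12_block_sum[OF assms] by simp

lemma block_lift_swap23:
  assumes "a permutes {1..m}" "b permutes {1..m}" "c permutes {1..m}"
  shows "block_lift a b c \<cdot> positive_lift (3 * m) (block_swap23 m)
    = positive_lift (3 * m) (block_swap23 m) \<cdot> block_lift a c b"
  using positive_lift_comp[OF block_sum_permutes[OF assms] block_swap23_permutes
      no_double_inversion_block_sum_swap(2)[OF assms]]
    positive_lift_comp[OF block_swap23_permutes block_sum_permutes[OF assms(1,3,2)]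
      no_double_inversion_swap_block_sum(2)[OF assms(1,3,2)]]
    block_swap23_block_sum[OF assms] by simp

lemma block_swap_lift_braid:
  "positive_lift (3 * m) (block_swap12 m) \<cdot> positive_lift (3 * m) (block_swap23 m)
      \<cdot> positive_lift (3 * m) (block_swap12 m)
    = positive_lift (3 * m) (block_swap23 m) \<cdot> positive_lift (3 * m) (block_swap12 m)
      \<cdot> positive_lift (3 * m) (block_swap23 m)"
proof -
  note x = block_swap12_permutes[of m] and y = block_swap23_permutes[of m]
  note n = no_double_inversion_block_swaps[of m]
  show ?thesis
    using positive_lift_comp[OF x y n(1)] positive_lift_comp[OF y x n(2)]
      positive_lift_comp[OF permutes_compose[OF y x] x n(3)]
      positive_lift_comp[OF permutes_compose[OF x y] y n(4)] block_swap_braid[of m]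
    by simp
qed

text \<open>
  With \<open>u' = r u r\<close> and \<open>v = r u\<inverse> = u'\<inverse> r\<close> for \<open>u = (a, b, c)\<close> and \<open>r\<close> the blockwise reversal,
  both \<open>T\<^sub>v T\<^sub>u\<close> and \<open>T\<^bsub>u'\<^esub> T\<^sub>v\<close> are the blockwise half twist.
\<close>

lemma block_half_twist_commute:
  assumes a: "a permutes {1..m}" and b: "b permutes {1..m}" and c: "c permutes {1..m}"
  defines "r \<equiv> reversal m"
  shows "block_lift r r r \<cdot> block_lift a b c
    = block_lift (r \<circ> a \<circ> r) (r \<circ> b \<circ> r) (r \<circ> c \<circ> r) \<cdot> block_lift r r r"
proof -
  have r: "r permutes {1..m}" unfolding r_def by (rule reversal_permutes)
  have perm: "(r \<circ> inv' u) permutes {1..m}" "(r \<circ> u \<circ> r) permutes {1..m}"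
    and comp: "r \<circ> inv' u \<circ> u = r" "r \<circ> u \<circ> r \<circ> (r \<circ> inv' u) = r"
    and nd: "no_double_inversion (r \<circ> inv' u) u" "no_double_inversion (r \<circ> u \<circ> r) (r \<circ> inv' u)"
    if u: "u permutes {1..m}" for u
  proof -
    show p: "(r \<circ> inv' u) permutes {1..m}" "(r \<circ> u \<circ> r) permutes {1..m}"
      using permutes_compose r u permutes_inv[OF u] by blast+
    show c: "r \<circ> inv' u \<circ> u = r" "r \<circ> u \<circ> r \<circ> (r \<circ> inv' u) = r"
      using permutes_inverses[OF u] by (auto simp: r_def fun_eq_iff)
    show "no_double_inversion (r \<circ> inv' u) u"
      by (rule no_double_inversion_reversal[OF u]) (use c in \<open>simp add: r_def\<close>)
    show "no_double_inversion (r \<circ> u \<circ> r) (r \<circ> inv' u)"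
      by (rule no_double_inversion_reversal[OF p(1)]) (use c in \<open>simp add: r_def\<close>)
  qed
  let ?U = "block_lift a b c" and ?R = "block_lift r r r"
  let ?U' = "block_lift (r \<circ> a \<circ> r) (r \<circ> b \<circ> r) (r \<circ> c \<circ> r)"
  let ?V = "block_lift (r \<circ> inv' a) (r \<circ> inv' b) (r \<circ> inv' c)"
  have "?V \<cdot> ?U = ?R"
    using block_lift_mult[OF perm(1)[OF a] a nd(1)[OF a] perm(1)[OF b] b nd(1)[OF b]
        perm(1)[OF c] c nd(1)[OF c]]
    by (simp only: comp[OF a] comp[OF b] comp[OF c])
  moreover have "?U' \<cdot> ?V = ?R"
    using block_lift_mult[OF perm(2,1)[OF a] nd(2)[OF a] perm(2,1)[OF b] nd(2)[OF b]
        perm(2,1)[OF c] nd(2)[OF c]]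
    by (simp only: comp[OF a] comp[OF b] comp[OF c])
  moreover have "?U' \<cdot> ?V \<cdot> ?U = ?U' \<cdot> (?V \<cdot> ?U)"
    using a b c perm by (intro m_assoc block_lift_closed) auto
  ultimately show ?thesis by simp
qed

text \<open>Both sides are brought to the lift of \<open>(d, d', d)\<close> times the square of the
  blockwise half twist, which is symmetric in the outer blocks.\<close>

lemma block_lift_reorder:
  assumes d: "d permutes {1..m}"
  defines "r \<equiv> reversal m"
  shows "block_lift d r r \<cdot> block_lift r d r \<cdot> block_lift r r d
    = block_lift r r d \<cdot> block_lift r d r \<cdot> block_lift d r r"
proof -
  \<comment> \<open>What \<open>d\<close> turns into when its lift passes one half twist.\<close>
  define d' where "d' = r \<circ> d \<circ> r"
  have r: "r permutes {1..m}" unfolding r_def by (rule reversal_permutes)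
  have d': "d' permutes {1..m}" unfolding d'_def using permutes_compose r d by blast
  have i: "id permutes {1..m}" by (rule permutes_id)
  have rr: "r \<circ> r = id" and rd'r: "r \<circ> d' \<circ> r = d"
    by (auto simp: r_def d'_def fun_eq_iff)
  note perms = r d d' i
  note closed = block_lift_closed and mult = block_lift_mult
  let ?R = "block_lift r r r"
  let ?D1 = "block_lift d id id" and ?D2 = "block_lift id d id" and ?D3 = "block_lift id id d"
  let ?D1' = "block_lift d' id id" and ?D2' = "block_lift id d' id" and ?D3' = "block_lift id id d'"
  have [simp]: "block_lift a b c \<in> carrier (braid_monoid (3 * m))"
    if "a \<in> {r, d, d', id}" "b \<in> {r, d, d', id}" "c \<in> {r, d, d', id}" for a b c
    using that perms by (intro closed) auto
  \<comment> \<open>Isolating the component \<open>d\<close> lets the reversals of neighbouring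
    factors merge into full blockwise half twists \<open>?R\<close>. Two splittings are recorded,
    one for each order of the three factors.\<close>
  have split:
    "block_lift d r r = ?D1 \<cdot> block_lift id r r" "block_lift d r r = block_lift id r r \<cdot> ?D1"
    "block_lift r d r = block_lift r id id \<cdot> block_lift id d r"
    "block_lift r d r = block_lift id id r \<cdot> block_lift r d id"
    "block_lift r r d = block_lift r r id \<cdot> ?D3" "block_lift r r d = ?D3 \<cdot> block_lift r r id"
    "block_lift id d r = ?D2 \<cdot> block_lift id id r"
    "block_lift r d id = ?D2 \<cdot> block_lift r id id"
    "block_lift id r r \<cdot> block_lift r id id = ?R"
    "block_lift r r id \<cdot> block_lift id id r = ?R"
    "block_lift id id r \<cdot> block_lift r r id = ?R"
    "block_lift r id id \<cdot> block_lift id r r = ?R"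
    by (subst mult; simp add: perms del: One_nat_def)+
  have half_twist: "?R \<cdot> ?D1 = ?D1' \<cdot> ?R" "?R \<cdot> ?D2 = ?D2' \<cdot> ?R" "?R \<cdot> ?D3 = ?D3' \<cdot> ?R"
    "?R \<cdot> ?D1' = ?D1 \<cdot> ?R" "?R \<cdot> ?D3' = ?D3 \<cdot> ?R"
    using block_half_twist_commute[folded r_def] perms
    by (simp_all add: rr rd'r flip: d'_def del: One_nat_def)
  have pull: "?R \<cdot> (?D2 \<cdot> z) = ?D2' \<cdot> (?R \<cdot> z)" "?R \<cdot> (?D1' \<cdot> z) = ?D1 \<cdot> (?R \<cdot> z)"
    "?R \<cdot> (?D3' \<cdot> z) = ?D3 \<cdot> (?R \<cdot> z)"
    if [simp]: "z \<in> carrier (braid_monoid (3 * m))" for z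
    using half_twist by (simp_all flip: m_assoc)
  \<comment> \<open>The factors live in different blocks, so their order is immaterial.\<close>
  have diagonal: "?D1 \<cdot> ?D2' \<cdot> ?D3 = block_lift d d' d" "?D3 \<cdot> ?D2' \<cdot> ?D1 = block_lift d d' d"
    by (simp_all add: mult perms del: One_nat_def)
  have "block_lift d r r \<cdot> block_lift r d r \<cdot> block_lift r r d
      = ?D1 \<cdot> (block_lift id r r \<cdot> block_lift r id id) \<cdot> ?D2
        \<cdot> (block_lift id id r \<cdot> block_lift r r id) \<cdot> ?D3"
    unfolding split(1,3,5,7) by (simp add: m_assoc)
  also have "\<dots> = ?D1 \<cdot> ?R \<cdot> ?D2 \<cdot> ?R \<cdot> ?D3"
    by (simp only: split(9-12))
  \<comment> \<open>The middle factor passes one half twist and becomes \<open>?D2'\<close>; the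
    last passes two and returns to itself.\<close>
  also have "\<dots> = ?D1 \<cdot> ?D2' \<cdot> ?D3 \<cdot> (?R \<cdot> ?R)"
    by (simp add: m_assoc half_twist(3) pull)
  also have "\<dots> = ?D3 \<cdot> ?D2' \<cdot> ?D1 \<cdot> (?R \<cdot> ?R)"
    by (simp only: diagonal)
  also have "\<dots> = ?D3 \<cdot> ?R \<cdot> ?D2 \<cdot> ?R \<cdot> ?D1"
    by (simp add: m_assoc half_twist(1) pull)
  also have "\<dots> = ?D3 \<cdot> (block_lift r r id \<cdot> block_lift id id r) \<cdot> ?D2
        \<cdot> (block_lift r id id \<cdot> block_lift id r r) \<cdot> ?D1"
    by (simp only: split(9-12))
  also have "\<dots> = block_lift r r d \<cdot> block_lift r d r \<cdot> block_lift d r r"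
    unfolding split(2,4,6,8) by (simp add: m_assoc)
  finally show ?thesis .
qed

lemma braid_relation_longest_elements:
  assumes J: "J \<subseteq> {1..m - 1}"
  defines "A \<equiv> positive_lift (3 * m)
      (longest_element (3 * m) ({1..2 * m - 1} \<union> (+) (2 * m) ` J))"
    and "B \<equiv> positive_lift (3 * m) (longest_element (3 * m) ({m + 1..3 * m - 1} \<union> J))"
  shows "A \<in> carrier (braid_monoid (3 * m))" "B \<in> carrier (braid_monoid (3 * m))"
    "A \<cdot> B \<cdot> A = B \<cdot> A \<cdot> B"
proof -
  let ?r = "reversal m" and ?d = "longest_element m J"
  let ?x = "positive_lift (3 * m) (block_swap12 m)" and ?y = "positive_lift (3 * m) (block_swap23 m)"
  have "J \<subseteq> {1..<m}" using J by fastforce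
  note d = longest_element[OF this]
  note perms = d(1) reversal_permutes[of m]
  note closed = positive_lift_closed[OF block_swap12_permutes] positive_lift_closed[OF block_swap23_permutes]
    block_lift_closed
  \<comment> \<open>Inversions of the block sum stay inside blocks and the swap preserves them, so
    the lift factors.\<close>
  have A: "A = ?x \<cdot> block_lift ?r ?r ?d"
    unfolding A_def longest_element_left[OF J d] using perms
    by (intro positive_lift_comp no_double_inversion_swap_block_sum block_sum_permutes
        block_swap12_permutes)
  have B: "B = ?y \<cdot> block_lift ?d ?r ?r"
    unfolding B_def longest_element_right[OF J d] using perms
    by (intro positive_lift_comp no_double_inversion_swap_block_sum block_sum_permutes
        block_swap23_permutes)
  show "A \<in> carrier (braid_monoid (3 * m))" "B \<in> carrier (braid_monoid (3 * m))"
    unfolding A B using perms by (intro m_closed closed; simp)+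
  show "A \<cdot> B \<cdot> A = B \<cdot> A \<cdot> B"
    unfolding A B
    \<comment> \<open>The middle position of \<open>d\<close> links its two outer positions, one
      swap away from each.\<close>
    by (rule braid_relation_of_swaps[where q = "block_lift ?r ?d ?r"])
      (intro closed block_lift_swap12 block_lift_swap23 block_swap_lift_braid
        block_lift_reorder perms)+
qed

end

theorem theorem6p6:
  fixes m :: nat and J :: "nat set"
  assumes "m > 0" and "J \<subseteq> {1..m - 1}"
  shows "\<exists>!\<phi>. \<phi> \<in> monoid_homs (braid_monoid 3) (braid_monoid (3 * m))
      \<and> \<phi> \<in> extensional (carrier (braid_monoid 3))
      \<and> \<phi> (braid_gen 3 1)
          = positive_lift (3 * m) (longest_element (3 * m) ({1..2 * m - 1} \<union> (+) (2 * m) ` J))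
      \<and> \<phi> (braid_gen 3 2)
          = positive_lift (3 * m) (longest_element (3 * m) ({m + 1..3 * m - 1} \<union> J))"
    (is "\<exists>!\<phi>. _ \<and> _ \<and> _ = ?A \<and> _ = ?B")
proof -
  interpret monoid "braid_monoid (3 * m)" by (rule monoid_braid_monoid)
  note AB = braid_relation_longest_elements[OF assms(2)]
  \<comment> \<open>Only the indices 1 and 2 are generators, so a single default branch serves for
    the second.\<close>
  define f :: "nat \<Rightarrow> nat list set" where "f i = (if i = 1 then ?A else ?B)" for i
  have f: "f 1 = ?A" "f 2 = ?B" by (simp_all add: f_def)
  have f_closed: "f \<in> {1..<3} \<rightarrow> carrier (braid_monoid (3 * m))"
    using AB by (simp add: f_def)
  \<comment> \<open>The single defining relation on three strands becomes the braid relation between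
    the two lifts.\<close>
  have "evaluate f u = evaluate f v" if "(u, v) \<in> braid_relations 3" for u v
  proof -
    show ?thesis
      unfolding braid_relations_3[OF that] using AB by (simp only: evaluate_simps f r_one m_assoc)
  qed
  from presented_monoid_universal[OF f_closed this]
  have "\<exists>!\<phi>. \<phi> \<in> monoid_homs (braid_monoid 3) (braid_monoid (3 * m))
      \<and> \<phi> \<in> extensional (carrier (braid_monoid 3)) \<and> (\<forall>i\<in>{1..<3}. \<phi> (braid_gen 3 i) = f i)"
    by (simp only: braid_monoid_def braid_gen_def)
  moreover have "(\<forall>i\<in>{1..<3}. \<phi> (braid_gen 3 i) = f i)
      \<longleftrightarrow> \<phi> (braid_gen 3 1) = ?A \<and> \<phi> (braid_gen 3 2) = ?B" for \<phi>
  proof -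
    have "{1..<3} = {1, 2 :: nat}" by auto
    then show ?thesis by (simp only: ball_simps f simp_thms)
  qed
  ultimately show ?thesis by (simp only:)
qed

end
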